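(* If a strongly regular configuration with parameters $(v_k;\lambda,\mu)$ exists, then $(v-k)(\lambda+1)\ge k(k-1)^3$. Moreover, equality holds if and only if the configuration is a partial geometry.
   Context: A symmetric $(v_k)$ configuration is a finite incidence structure of $v$ points and $v$ lines such that every line has exactly $k$ points, every point lies on exactly $k$ lines, and two distinct points lie on at most one common line; $k\ge 3$. Its point graph has the points as vertices, two distinct points adjacent iff they lie on a common line. A strongly regular configuration with parameters $(v_k;\lambda,\mu)$ is a symmetric $(v_k)$ configuration whose point graph is a strongly regular graph $SRG(v,k(k-1),\lambda,\mu)$. A configuration is a partial geometry if there is a constant $\alpha$ such that for every point $P$ and line $\ell$ with $P$ not on $\ell$, exactly $\alpha$ points of $\ell$ are collinear with $P$. *)

theory Defs
  imports Main
begin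

text \<open>
  A simple graph is given by its vertex set and an adjacency relation, which only matters on
  the vertex set. Complete graphs are not excluded; for them the condition on \<open>mu\<close> is vacuous.
\<close>

locale strongly_regular_graph =
  fixes V :: "'a set" and adj :: "'a \<Rightarrow> 'a \<Rightarrow> bool"
    and v d lam mu :: nat
  assumes finite_vertices: "finite V"
    and nonempty: "V \<noteq> {}"
    and card_vertices: "card V = v"
    and irreflexive: "\<And>x. x \<in> V \<Longrightarrow> \<not> adj x x"
    and symmetric: "\<And>x y. x \<in> V \<Longrightarrow> y \<in> V \<Longrightarrow> adj x y \<Longrightarrow> adj y x"
    and regular: "\<And>x. x \<in> V \<Longrightarrow> card {y \<in> V. adj x y} = d"
    and common_adjacent:
      "\<And>x y. x \<in> V \<Longrightarrow> y \<in> V \<Longrightarrow> adj x y \<Longrightarrow>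
        card {z \<in> V. adj x z \<and> adj y z} = lam"
    and common_nonadjacent:
      "\<And>x y. x \<in> V \<Longrightarrow> y \<in> V \<Longrightarrow> x \<noteq> y \<Longrightarrow> \<not> adj x y \<Longrightarrow>
        card {z \<in> V. adj x z \<and> adj y z} = mu"

text \<open>
  The incidence relation \<open>I p l\<close> only matters for \<open>p \<in> P\<close> and \<open>l \<in> L\<close>.
  The empty structure is excluded; it would satisfy all other conditions for every \<open>k \<ge> 3\<close>.
\<close>

definition collinear :: "'l set \<Rightarrow> ('p \<Rightarrow> 'l \<Rightarrow> bool) \<Rightarrow> 'p \<Rightarrow> 'p \<Rightarrow> bool" where
  "collinear L I p q \<longleftrightarrow> (\<exists>l\<in>L. I p l \<and> I q l)"

definition point_graph_adj :: "'l set \<Rightarrow> ('p \<Rightarrow> 'l \<Rightarrow> bool) \<Rightarrow> 'p \<Rightarrow> 'p \<Rightarrow> bool" where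
  "point_graph_adj L I p q \<longleftrightarrow> p \<noteq> q \<and> collinear L I p q"

locale symmetric_configuration =
  fixes P :: "'p set" and L :: "'l set" and I :: "'p \<Rightarrow> 'l \<Rightarrow> bool"
    and v k :: nat
  assumes finite_points: "finite P"
    and finite_lines: "finite L"
    and points_nonempty: "P \<noteq> {}"
    and card_points: "card P = v"
    and card_lines: "card L = v"
    and k_ge_3: "k \<ge> 3"
    and points_per_line: "\<And>l. l \<in> L \<Longrightarrow> card {p \<in> P. I p l} = k"
    and lines_per_point: "\<And>p. p \<in> P \<Longrightarrow> card {l \<in> L. I p l} = k"
    and at_most_one_line:
      "\<And>p q l m. p \<in> P \<Longrightarrow> q \<in> P \<Longrightarrow> p \<noteq> q \<Longrightarrow> l \<in> L \<Longrightarrow> m \<in> L \<Longrightarrow>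
        I p l \<Longrightarrow> I q l \<Longrightarrow> I p m \<Longrightarrow> I q m \<Longrightarrow> l = m"

locale strongly_regular_configuration =
  symmetric_configuration P L I v k +
  strongly_regular_graph P "point_graph_adj L I" v "k * (k - 1)" lam mu
  for P :: "'p set" and L :: "'l set" and I :: "'p \<Rightarrow> 'l \<Rightarrow> bool"
    and v k lam mu :: nat

definition partial_geometry ::
  "'p set \<Rightarrow> 'l set \<Rightarrow> ('p \<Rightarrow> 'l \<Rightarrow> bool) \<Rightarrow> nat \<Rightarrow> nat \<Rightarrow> bool" where
  "partial_geometry P L I v k \<longleftrightarrow>
    symmetric_configuration P L I v k \<and>
    (\<exists>\<alpha>. \<forall>p\<in>P. \<forall>l\<in>L. \<not> I p l \<longrightarrow> card {q \<in> P. I q l \<and> collinear L I q p} = \<alpha>)"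

end

theory Submission
  imports Defs
begin

text \<open>
  Fix a line \<open>l\<close> and let \<open>x p\<close> be the number of points of \<open>l\<close> collinear with a point \<open>p\<close> off \<open>l\<close>.
  Double counting shows that the first two moments of \<open>x\<close> over the \<open>v - k\<close> points off \<open>l\<close> are
  \<open>k (k - 1)\<^sup>2\<close> and \<open>k (k - 1) (\<lambda> + 1)\<close>. Up to a positive factor, the difference of the two sides
  of the inequality is therefore the variance of \<open>x\<close>. Hence it is nonnegative, and it vanishes
  iff \<open>x\<close> is constant; the constant is then the mean of \<open>x\<close>, which is the same for every line.
\<close>

text \<open>This is the variance identity with every deviation from the mean multiplied by
  \<open>card A\<close>. Clearing the denominator this way lets it be used over the
  integers.\<close>

lemma sum_square_deviation:
  fixes x :: "'a \<Rightarrow> 'b::comm_ring_1"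
  shows "(\<Sum>a\<in>A. (of_nat (card A) * x a - (\<Sum>b\<in>A. x b))\<^sup>2) =
    of_nat (card A) * (of_nat (card A) * (\<Sum>a\<in>A. (x a)\<^sup>2) - (\<Sum>a\<in>A. x a)\<^sup>2)"
proof -
  define n S where "n = (of_nat (card A) :: 'b)" and "S = (\<Sum>a\<in>A. x a)"
  have "(\<Sum>a\<in>A. (n * x a - S)\<^sup>2) = (\<Sum>a\<in>A. n\<^sup>2 * (x a)\<^sup>2 - 2 * n * S * x a + S\<^sup>2)"
    by (intro sum.cong refl) (simp add: power2_eq_square algebra_simps)
  also have "\<dots> = n\<^sup>2 * (\<Sum>a\<in>A. (x a)\<^sup>2) - 2 * n * S * S + n * S\<^sup>2"
    by (simp add: sum.distrib sum_subtractf sum_distrib_left n_def S_def)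
  also have "\<dots> = n * (n * (\<Sum>a\<in>A. (x a)\<^sup>2) - S\<^sup>2)"
    by (simp add: power2_eq_square algebra_simps)
  finally show ?thesis
    by (simp add: n_def S_def)
qed

lemma sum_of_bool_eq_card:
  "finite A \<Longrightarrow> (\<Sum>a\<in>A. of_bool (Q a)) = (of_nat (card {a \<in> A. Q a}) :: 'b::semiring_1)"
  by (simp add: Int_def)

context strongly_regular_configuration
begin

abbreviation adj :: "'p \<Rightarrow> 'p \<Rightarrow> bool" where
  "adj \<equiv> point_graph_adj L I"

definition points_on :: "'l \<Rightarrow> 'p set" where
  "points_on l = {p \<in> P. I p l}"

definition points_off :: "'l \<Rightarrow> 'p set" where
  "points_off l = {p \<in> P. \<not> I p l}"

text \<open>The set is literally the one in \<open>partial_geometry\<close>, so that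
  \<open>partial_geometry_iff\<close> follows by unfolding.\<close>

definition collinear_count :: "'l \<Rightarrow> 'p \<Rightarrow> nat" where
  "collinear_count l p = card {q \<in> P. I q l \<and> collinear L I q p}"

lemma finite_points_on: "finite (points_on l)"
  and finite_points_off: "finite (points_off l)"
  using finite_points by (simp_all add: points_on_def points_off_def)

lemma card_points_on: "l \<in> L \<Longrightarrow> card (points_on l) = k"
  by (simp add: points_on_def points_per_line)

lemma card_points_on_le: "l \<in> L \<Longrightarrow> k \<le> v"
  using card_mono[OF finite_points, of "points_on l"] card_points_on card_points
  by (auto simp: points_on_def)

lemma card_points_off: "l \<in> L \<Longrightarrow> int (card (points_off l)) = int v - int k"
proof -
  assume l: "l \<in> L"
  have "points_off l = P - points_on l" "points_on l \<subseteq> P"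
    by (auto simp: points_on_def points_off_def)
  then show ?thesis
    using l card_points_on_le by (simp add: card_Diff_subset finite_points_on card_points_on card_points)
qed

lemma adj_points_on: "\<lbrakk>l \<in> L; q \<in> points_on l; r \<in> points_on l; q \<noteq> r\<rbrakk> \<Longrightarrow> adj q r"
  by (auto simp: points_on_def point_graph_adj_def collinear_def)

lemma not_adj_self: "\<not> adj q q"
  by (simp add: point_graph_adj_def)

text \<open>Of the k(k - 1) neighbours of \<open>q\<close>, exactly k - 1 are the other points of
  \<open>l\<close>; the rest lie off \<open>l\<close>.\<close>

lemma card_neighbours_off:
  assumes l: "l \<in> L" and q: "q \<in> points_on l"
  shows "int (card {p \<in> points_off l. adj q p}) = (int k - 1)\<^sup>2"
proof -
  have "{p \<in> P. adj q p} = {p \<in> points_off l. adj q p} \<union> (points_on l - {q})"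
    using adj_points_on[OF l q] not_adj_self[of q] by (auto simp: points_on_def points_off_def)
  moreover have "card ({p \<in> points_off l. adj q p} \<union> (points_on l - {q})) =
      card {p \<in> points_off l. adj q p} + card (points_on l - {q})"
    using finite_points by (intro card_Un_disjoint) (auto simp: points_on_def points_off_def)
  moreover have "card (points_on l - {q}) = k - 1"
    using q l by (simp add: card_points_on finite_points_on)
  moreover have "card {p \<in> P. adj q p} = k * (k - 1)"
    using q regular by (simp add: points_on_def)
  ultimately have "int (k * (k - 1)) = int (card {p \<in> points_off l. adj q p}) + int (k - 1)"
    by (metis of_nat_add)
  then show ?thesis
    using k_ge_3 by (simp add: of_nat_diff power2_eq_square algebra_simps)
qed

text \<open>Two points of \<open>l\<close> are adjacent, so they have \<open>lam\<close> common
  neighbours, among them the k - 2 remaining points of \<open>l\<close>.\<close>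

lemma card_common_neighbours_off:
  assumes l: "l \<in> L" and q: "q \<in> points_on l" and r: "r \<in> points_on l" and "q \<noteq> r"
  shows "int (card {p \<in> points_off l. adj q p \<and> adj r p}) = int lam - int k + 2"
proof -
  have "{p \<in> P. adj q p \<and> adj r p} =
      {p \<in> points_off l. adj q p \<and> adj r p} \<union> (points_on l - {q, r})"
    using adj_points_on[OF l q] adj_points_on[OF l r] not_adj_self
    by (auto simp: points_on_def points_off_def)
  moreover have "card ({p \<in> points_off l. adj q p \<and> adj r p} \<union> (points_on l - {q, r})) =
      card {p \<in> points_off l. adj q p \<and> adj r p} + card (points_on l - {q, r})"
    using finite_points by (intro card_Un_disjoint) (auto simp: points_on_def points_off_def)
  moreover have "card (points_on l - {q, r}) = k - 2"
    using q r l \<open>q \<noteq> r\<close> by (simp add: card_Diff_subset card_points_on)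
  moreover have "card {p \<in> P. adj q p \<and> adj r p} = lam"
    using q r adj_points_on[OF l q r \<open>q \<noteq> r\<close>] common_adjacent by (simp add: points_on_def)
  ultimately have "int lam = int (card {p \<in> points_off l. adj q p \<and> adj r p}) + int (k - 2)"
    by simp
  then show ?thesis
    using k_ge_3 by (simp add: of_nat_diff)
qed

lemma collinear_count_eq_sum:
  assumes "p \<in> points_off l"
  shows "int (collinear_count l p) = (\<Sum>q\<in>points_on l. of_bool (adj q p))"
proof -
  \<comment> \<open>A point off \<open>l\<close> differs from every point on \<open>l\<close>, so
    here collinearity and adjacency agree.\<close>
  have "{q \<in> P. I q l \<and> collinear L I q p} = {q \<in> points_on l. adj q p}"
    using assms by (auto simp: points_on_def points_off_def point_graph_adj_def)
  then show ?thesis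
    by (simp only: collinear_count_def sum_of_bool_eq_card[OF finite_points_on])
qed

text \<open>Both sides count adjacent pairs of a point off \<open>l\<close> and a point on
  \<open>l\<close>; each of the k points of \<open>l\<close> contributes (k - 1)^2.\<close>

lemma sum_collinear_count:
  assumes l: "l \<in> L"
  shows "(\<Sum>p\<in>points_off l. int (collinear_count l p)) = int k * (int k - 1)\<^sup>2"
proof -
  have "(\<Sum>p\<in>points_off l. int (collinear_count l p)) =
      (\<Sum>p\<in>points_off l. \<Sum>q\<in>points_on l. of_bool (adj q p))"
    by (intro sum.cong refl collinear_count_eq_sum)
  also have "\<dots> = (\<Sum>q\<in>points_on l. \<Sum>p\<in>points_off l. of_bool (adj q p))"
    by (rule sum.swap)
  also have "\<dots> = (\<Sum>q\<in>points_on l. (int k - 1)\<^sup>2)"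
    by (intro sum.cong refl)
      (simp only: sum_of_bool_eq_card[OF finite_points_off] card_neighbours_off[OF l])
  finally show ?thesis
    by (simp add: card_points_on[OF l])
qed

text \<open>The square counts ordered pairs (q, r) of points of \<open>l\<close> that are both
  adjacent to \<open>p\<close>. After exchanging the sums, the inner sum over \<open>p\<close>
  counts the common neighbours of \<open>q\<close> and \<open>r\<close> off
  \<open>l\<close>.\<close>

lemma sum_collinear_count_square:
  assumes l: "l \<in> L"
  shows "(\<Sum>p\<in>points_off l. (int (collinear_count l p))\<^sup>2) = int k * (int k - 1) * (int lam + 1)"
proof -
  have common: "(\<Sum>p\<in>points_off l. of_bool (adj q p) * of_bool (adj r p)) =
      (if r = q then (int k - 1)\<^sup>2 else int lam - int k + 2)"
    if "q \<in> points_on l" "r \<in> points_on l" for q r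
    unfolding of_bool_conj[symmetric] sum_of_bool_eq_card[OF finite_points_off]
    using card_neighbours_off[OF l] card_common_neighbours_off[OF l] that by simp
  \<comment> \<open>The term r = q and the k - 1 other terms add up to (k - 1)((k - 1) + (lam - k +
    2)).\<close>
  have inner: "(\<Sum>r\<in>points_on l. if r = q then (int k - 1)\<^sup>2 else int lam - int k + 2) =
      (int k - 1) * (int lam + 1)" if q: "q \<in> points_on l" for q
  proof -
    have "(\<Sum>r\<in>points_on l - {q}. if r = q then (int k - 1)\<^sup>2 else int lam - int k + 2) =
        (\<Sum>r\<in>points_on l - {q}. int lam - int k + 2)"
      by (intro sum.cong) auto
    also have "\<dots> = (int k - 1) * (int lam - int k + 2)"
      using q l k_ge_3 by (simp add: card_points_on finite_points_on of_nat_diff)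
    finally show ?thesis
      by (simp add: sum.remove[OF finite_points_on q] power2_eq_square algebra_simps)
  qed
  have "(\<Sum>p\<in>points_off l. (int (collinear_count l p))\<^sup>2) =
      (\<Sum>p\<in>points_off l. \<Sum>q\<in>points_on l. \<Sum>r\<in>points_on l. of_bool (adj q p) * of_bool (adj r p))"
    by (intro sum.cong refl) (simp only: collinear_count_eq_sum power2_eq_square sum_product)
  also have "\<dots> = (\<Sum>q\<in>points_on l. \<Sum>p\<in>points_off l. \<Sum>r\<in>points_on l.
      of_bool (adj q p) * of_bool (adj r p))"
    by (rule sum.swap)
  also have "\<dots> = (\<Sum>q\<in>points_on l. \<Sum>r\<in>points_on l. \<Sum>p\<in>points_off l.
      of_bool (adj q p) * of_bool (adj r p))"
    by (intro sum.cong refl sum.swap)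
  also have "\<dots> = (\<Sum>q\<in>points_on l. (int k - 1) * (int lam + 1))"
    by (intro sum.cong refl) (simp only: common inner cong: sum.cong)
  finally show ?thesis
    by (simp add: card_points_on[OF l])
qed

text \<open>No point is its own neighbour, so the degree k(k - 1), which is at least k, is below v.
  This makes v - k positive, hence cancellable.\<close>

lemma less_card_points: "k < v"
proof -
  obtain p where p: "p \<in> P"
    using points_nonempty by auto
  have "{q \<in> P. adj p q} \<subset> P"
    using p not_adj_self by auto
  then have "k * (k - 1) < v"
    using psubset_card_mono[OF finite_points] regular[OF p] card_points by metis
  moreover have "k * 1 \<le> k * (k - 1)"
    using k_ge_3 by (intro mult_left_mono) auto
  ultimately show ?thesis
    by linarith
qed

text \<open>Substituting both moments into the variance identity leaves the common factor k(k - 1),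
  which splits off the difference of the two sides of the inequality.\<close>

lemma sum_square_deviation_collinear_count:
  assumes l: "l \<in> L"
  shows "(\<Sum>p\<in>points_off l.
      ((int v - int k) * int (collinear_count l p) - int k * (int k - 1)\<^sup>2)\<^sup>2) =
    (int v - int k) * int k * (int k - 1) *
      ((int v - int k) * (int lam + 1) - int k * (int k - 1) ^ 3)"
  using sum_square_deviation[where x = "\<lambda>p. int (collinear_count l p)" and A = "points_off l"]
  unfolding card_points_off[OF l] sum_collinear_count[OF l] sum_collinear_count_square[OF l]
  by (simp add: power2_eq_square power3_eq_cube algebra_simps)

lemma factor_pos: "(int v - int k) * int k * (int k - 1) > 0"
  using less_card_points k_ge_3 by simp

lemma lines_nonempty: "L \<noteq> {}"
  using less_card_points card_lines by auto

lemma parameter_inequality: "int k * (int k - 1) ^ 3 \<le> (int v - int k) * (int lam + 1)"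
proof -
  obtain l where l: "l \<in> L"
    using lines_nonempty by auto
  have "0 \<le> (int v - int k) * int k * (int k - 1) *
      ((int v - int k) * (int lam + 1) - int k * (int k - 1) ^ 3)"
    unfolding sum_square_deviation_collinear_count[OF l, symmetric] by (rule sum_nonneg) simp
  then show ?thesis
    using factor_pos by (simp add: zero_le_mult_iff)
qed

text \<open>A sum of squares vanishes iff each square does. The left side does not mention
  \<open>l\<close>, so the condition holds for every line once it holds for one.\<close>

lemma parameter_equality_iff:
  assumes l: "l \<in> L"
  shows "(int v - int k) * (int lam + 1) = int k * (int k - 1) ^ 3 \<longleftrightarrow>
    (\<forall>p\<in>points_off l. (int v - int k) * int (collinear_count l p) = int k * (int k - 1)\<^sup>2)"
proof -
  have "(int v - int k) * (int lam + 1) = int k * (int k - 1) ^ 3 \<longleftrightarrow>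
      (\<Sum>p\<in>points_off l.
        ((int v - int k) * int (collinear_count l p) - int k * (int k - 1)\<^sup>2)\<^sup>2) = 0"
    unfolding sum_square_deviation_collinear_count[OF l] using less_card_points k_ge_3 by simp
  also have "\<dots> \<longleftrightarrow>
      (\<forall>p\<in>points_off l. (int v - int k) * int (collinear_count l p) = int k * (int k - 1)\<^sup>2)"
    by (simp add: sum_nonneg_eq_0_iff finite_points_off)
  finally show ?thesis .
qed

lemma partial_geometry_iff:
  "partial_geometry P L I v k \<longleftrightarrow> (\<exists>\<alpha>. \<forall>l\<in>L. \<forall>p\<in>points_off l. collinear_count l p = \<alpha>)"
  using symmetric_configuration_axioms
  unfolding partial_geometry_def points_off_def collinear_count_def by blast

lemma parameter_equality_iff_partial_geometry:
  "(int v - int k) * (int lam + 1) = int k * (int k - 1) ^ 3 \<longleftrightarrow> partial_geometry P L I v k"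
proof
  assume eq: "(int v - int k) * (int lam + 1) = int k * (int k - 1) ^ 3"
  \<comment> \<open>The witness for \<alpha> is the mean, which is independent of \<open>l\<close>;
    the product equation below shows that the division is exact.\<close>
  have "collinear_count l p = nat (int k * (int k - 1)\<^sup>2 div (int v - int k))"
    if "l \<in> L" "p \<in> points_off l" for l p
  proof -
    have "int k * (int k - 1)\<^sup>2 = (int v - int k) * int (collinear_count l p)"
      using parameter_equality_iff[OF that(1)] eq that(2) by simp
    then show ?thesis
      using less_card_points by simp
  qed
  then show "partial_geometry P L I v k"
    unfolding partial_geometry_iff by blast
next
  assume "partial_geometry P L I v k"
  then obtain \<alpha> where \<alpha>: "\<And>l p. l \<in> L \<Longrightarrow> p \<in> points_off l \<Longrightarrow> collinear_count l p = \<alpha>"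
    unfolding partial_geometry_iff by blast
  obtain l where l: "l \<in> L"
    using lines_nonempty by auto
  \<comment> \<open>With all counts equal to \<alpha>, the first moment says that \<alpha> is the
    mean, so every deviation at this line is zero.\<close>
  have "(int v - int k) * int \<alpha> = int k * (int k - 1)\<^sup>2"
    using sum_collinear_count[OF l] \<alpha>[OF l] card_points_off[OF l] by simp
  then show "(int v - int k) * (int lam + 1) = int k * (int k - 1) ^ 3"
    using parameter_equality_iff[OF l] \<alpha>[OF l] by simp
qed

end

theorem theorem6:
  fixes P :: "'p set" and L :: "'l set" and I :: "'p \<Rightarrow> 'l \<Rightarrow> bool"
    and v k lam mu :: nat
  assumes "strongly_regular_configuration P L I v k lam mu"
  shows "(int v - int k) * (int lam + 1) \<ge> int k * (int k - 1) ^ 3 \<and>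
    ((int v - int k) * (int lam + 1) = int k * (int k - 1) ^ 3 \<longleftrightarrow> partial_geometry P L I v k)"
proof -
  interpret strongly_regular_configuration P L I v k lam mu
    by (fact assms)
  show ?thesis
    using parameter_inequality parameter_equality_iff_partial_geometry by blast
qed

end
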